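(* Let $\sim\ \in \{\sim_{\rm FB}, \sim_{\rm FB:ps}, \sim_{\rm RB}, \sim_{\rm FRB}\}$ and $P_1, P_2 \in \mathcal{P}_{\mathrm{reach}}$. If $P_1 \sim P_2$, then $P_1 \parallel_L P \sim P_2 \parallel_L P$ and $P \parallel_L P_1 \sim P \parallel_L P_2$ for all $P \in \mathcal{P}_{\mathrm{reach}}$ and all $L \subseteq A\setminus\{\tau\}$ such that $P_1 \parallel_L P,\ P_2 \parallel_L P,\ P \parallel_L P_1,\ P \parallel_L P_2 \in \mathcal{P}_{\mathrm{reach}}$.
   Context: Fix a countable set $A$ of actions containing an unobservable action $\tau$. Process terms are generated by $P ::= \mathbf{0} \mid a\,.\,P \mid a^{\dagger}.\,P \mid P + P \mid P \parallel_L P$ with $a \in A$ and $L \subseteq A \setminus \{\tau\}$; $a^\dagger$ marks an already executed action, and $P_1 \parallel_L P_2$ is CSP-style parallel composition. The predicate $\mathrm{initial}$ is the least one with: $\mathrm{initial}(\mathbf{0})$; $\mathrm{initial}(a.P)$ if $\mathrm{initial}(P)$; $\mathrm{initial}(P_1+P_2)$ and $\mathrm{initial}(P_1 \parallel_L P_2)$ if $\mathrm{initial}(P_1)\wedge \mathrm{initial}(P_2)$. The predicate $\mathrm{wf}$ is the least one with: $\mathrm{wf}(\mathbf{0})$; $\mathrm{wf}(a.P)$ if $\mathrm{initial}(P)$; $\mathrm{wf}(a^\dagger.P)$ if $\mathrm{wf}(P)$; $\mathrm{wf}(P_1+P_2)$ if $(\mathrm{wf}(P_1)\wedge\mathrm{initial}(P_2))\vee(\mathrm{initial}(P_1)\wedge\mathrm{wf}(P_2))$;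 $\mathrm{wf}(P_1\parallel_L P_2)$ if $\mathrm{wf}(P_1)\wedge\mathrm{wf}(P_2)$. Proof terms: $\theta ::= a \mid .\theta \mid +_l\theta \mid +_r\theta \mid \parallel_l\theta \mid \parallel_r\theta \mid \langle\theta,\theta\rangle$. The partial function $\mathrm{act}$ is: $\mathrm{act}(a)=a$; $\mathrm{act}(.\theta)=\mathrm{act}(+_l\theta)=\mathrm{act}(+_r\theta)=\mathrm{act}(\parallel_l\theta)=\mathrm{act}(\parallel_r\theta)=\mathrm{act}(\theta)$; $\mathrm{act}(\langle\theta_1,\theta_2\rangle)=\mathrm{act}(\theta_1)$ if $\mathrm{act}(\theta_1)=\mathrm{act}(\theta_2)$. The transition relation $\xrightarrow{\theta}$ on well-formed processes is the least one closed under: $a.P \xrightarrow{a} a^\dagger.P$ if $\mathrm{initial}(P)$; if $P\xrightarrow{\theta}P'$ then $a^\dagger.P \xrightarrow{.\theta} a^\dagger.P'$; if $P_1\xrightarrow{\theta}P_1'$ and $\mathrm{initial}(P_2)$ then $P_1+P_2\xrightarrow{+_l\theta}P_1'+P_2$; if $P_2\xrightarrow{\theta}P_2'$ and $\mathrm{initial}(P_1)$ then $P_1+P_2\xrightarrow{+_r\theta}P_1+P_2'$; if $P_1\xrightarrow{\theta}P_1'$ and $\mathrm{act}(\theta)\notin L$ then $P_1\parallel_L P_2\xrightarrow{\parallel_l\theta}P_1'\parallel_L P_2$; symmetrically $P_1\parallel_L P_2\xrightarrow{\parallel_r\theta}P_1\parallel_L P_2'$ if $P_2\xrightarrow{\theta}P_2'$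 and $\mathrm{act}(\theta)\notin L$; if $P_1\xrightarrow{\theta_1}P_1'$, $P_2\xrightarrow{\theta_2}P_2'$ and $\mathrm{act}(\theta_1)=\mathrm{act}(\theta_2)\in L$ then $P_1\parallel_L P_2\xrightarrow{\langle\theta_1,\theta_2\rangle}P_1'\parallel_L P_2'$. $\mathcal{P}_{\mathrm{reach}}$ is the set of processes reachable via these transitions from some initial process. A symmetric relation $\mathcal{B}$ over $\mathcal{P}_{\mathrm{reach}}$ is a forward bisimulation if whenever $(P_1,P_2)\in\mathcal{B}$, for each $P_1\xrightarrow{\theta_1}P_1'$ there is $P_2\xrightarrow{\theta_2}P_2'$ with $\mathrm{act}(\theta_1)=\mathrm{act}(\theta_2)$ and $(P_1',P_2')\in\mathcal{B}$; it is a reverse bisimulation if whenever $(P_1,P_2)\in\mathcal{B}$, for each $P_1'\xrightarrow{\theta_1}P_1$ there is $P_2'\xrightarrow{\theta_2}P_2$ with $\mathrm{act}(\theta_1)=\mathrm{act}(\theta_2)$ and $(P_1',P_2')\in\mathcal{B}$; it is a forward-reverse bisimulation if both clauses hold; it is a past-sensitive forward bisimulation if it is a forward bisimulation and $\mathrm{initial}(P_1)\Leftrightarrow\mathrm{initial}(P_2)$ for all $(P_1,P_2)\in\mathcal{B}$. $\sim_{\rm FB}$, $\sim_{\rm RB}$, $\sim_{\rm FRB}$, $\sim_{\rm FB:ps}$ denote the unions of all forward, reverse, forward-reverse, and past-sensitive forward bisimulations respectively.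
   Formalization: In the reverse clause (for RB and FRB) the predecessors P1' range only over reachable processes; if they ranged over all well-formed processes the claim would fail, since a reachable parallel composition can have an unreachable predecessor. *)

theory Defs
  imports Main "HOL-Library.Countable_Set"
begin

text \<open>
  The type of process terms is raw: it does not know the set \<open>A\<close> of actions nor the unobservable
  action \<open>\<tau>\<close>. The side conditions of the grammar, \<open>a \<in> A\<close> and \<open>L \<subseteq> A - {\<tau>}\<close>, are imposed by
  the set \<open>terms A \<tau>\<close> below. \<open>Done a P\<close> is the prefix by an already executed action.
\<close>

datatype 'a proc =
    Stop
  | Prefix 'a "'a proc"
  | Done 'a "'a proc"
  | Choice "'a proc" "'a proc"
  | Par "'a proc" "'a set" "'a proc"

inductive_set terms :: "'a set \<Rightarrow> 'a \<Rightarrow> 'a proc set" for A :: "'a set" and \<tau> :: 'a where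
  terms_Stop: "Stop \<in> terms A \<tau>"
| terms_Prefix: "a \<in> A \<Longrightarrow> P \<in> terms A \<tau> \<Longrightarrow> Prefix a P \<in> terms A \<tau>"
| terms_Done: "a \<in> A \<Longrightarrow> P \<in> terms A \<tau> \<Longrightarrow> Done a P \<in> terms A \<tau>"
| terms_Choice: "P1 \<in> terms A \<tau> \<Longrightarrow> P2 \<in> terms A \<tau> \<Longrightarrow> Choice P1 P2 \<in> terms A \<tau>"
| terms_Par: "P1 \<in> terms A \<tau> \<Longrightarrow> P2 \<in> terms A \<tau> \<Longrightarrow> L \<subseteq> A - {\<tau>} \<Longrightarrow> Par P1 L P2 \<in> terms A \<tau>"

inductive initial :: "'a proc \<Rightarrow> bool" where
  initial_Stop: "initial Stop"
| initial_Prefix: "initial P \<Longrightarrow> initial (Prefix a P)"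
| initial_Choice: "initial P1 \<Longrightarrow> initial P2 \<Longrightarrow> initial (Choice P1 P2)"
| initial_Par: "initial P1 \<Longrightarrow> initial P2 \<Longrightarrow> initial (Par P1 L P2)"

inductive well_formed :: "'a proc \<Rightarrow> bool" where
  wf_Stop: "well_formed Stop"
| wf_Prefix: "initial P \<Longrightarrow> well_formed (Prefix a P)"
| wf_Done: "well_formed P \<Longrightarrow> well_formed (Done a P)"
| wf_Choice: "(well_formed P1 \<and> initial P2) \<or> (initial P1 \<and> well_formed P2)
    \<Longrightarrow> well_formed (Choice P1 P2)"
| wf_Par: "well_formed P1 \<Longrightarrow> well_formed P2 \<Longrightarrow> well_formed (Par P1 L P2)"

datatype 'a proof_term =
    Act 'a
  | Dot "'a proof_term"
  | PlusL "'a proof_term"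
  | PlusR "'a proof_term"
  | ParL "'a proof_term"
  | ParR "'a proof_term"
  | Sync "'a proof_term" "'a proof_term"

fun act :: "'a proof_term \<Rightarrow> 'a option" where
  "act (Act a) = Some a"
| "act (Dot \<theta>) = act \<theta>"
| "act (PlusL \<theta>) = act \<theta>"
| "act (PlusR \<theta>) = act \<theta>"
| "act (ParL \<theta>) = act \<theta>"
| "act (ParR \<theta>) = act \<theta>"
| "act (Sync \<theta>1 \<theta>2) = (if act \<theta>1 = act \<theta>2 then act \<theta>1 else None)"

text \<open>
  Transitions relate well-formed processes only. In \<open>transition_ParL\<close> and \<open>transition_ParR\<close> this is a
  premise on the idle component; in the other rules it follows from the remaining premises.
\<close>

inductive transition :: "'a proc \<Rightarrow> 'a proof_term \<Rightarrow> 'a proc \<Rightarrow> bool" where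
  transition_Prefix: "initial P \<Longrightarrow> transition (Prefix a P) (Act a) (Done a P)"
| transition_Done: "transition P \<theta> P' \<Longrightarrow> transition (Done a P) (Dot \<theta>) (Done a P')"
| transition_ChoiceL: "transition P1 \<theta> P1' \<Longrightarrow> initial P2 \<Longrightarrow>
    transition (Choice P1 P2) (PlusL \<theta>) (Choice P1' P2)"
| transition_ChoiceR: "transition P2 \<theta> P2' \<Longrightarrow> initial P1 \<Longrightarrow>
    transition (Choice P1 P2) (PlusR \<theta>) (Choice P1 P2')"
| transition_ParL: "transition P1 \<theta> P1' \<Longrightarrow> act \<theta> = Some a \<Longrightarrow> a \<notin> L \<Longrightarrow> well_formed P2 \<Longrightarrow>
    transition (Par P1 L P2) (ParL \<theta>) (Par P1' L P2)"
| transition_ParR: "transition P2 \<theta> P2' \<Longrightarrow> act \<theta> = Some a \<Longrightarrow> a \<notin> L \<Longrightarrow> well_formed P1 \<Longrightarrow>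
    transition (Par P1 L P2) (ParR \<theta>) (Par P1 L P2')"
| transition_Sync: "transition P1 \<theta>1 P1' \<Longrightarrow> transition P2 \<theta>2 P2' \<Longrightarrow>
    act \<theta>1 = Some a \<Longrightarrow> act \<theta>2 = Some a \<Longrightarrow> a \<in> L \<Longrightarrow>
    transition (Par P1 L P2) (Sync \<theta>1 \<theta>2) (Par P1' L P2')"

inductive_set reach :: "'a set \<Rightarrow> 'a \<Rightarrow> 'a proc set" for A :: "'a set" and \<tau> :: 'a where
  reach_initial: "P \<in> terms A \<tau> \<Longrightarrow> initial P \<Longrightarrow> P \<in> reach A \<tau>"
| reach_step: "P \<in> reach A \<tau> \<Longrightarrow> transition P \<theta> P' \<Longrightarrow> P' \<in> reach A \<tau>"

definition rel_over_reach :: "'a set \<Rightarrow> 'a \<Rightarrow> ('a proc \<times> 'a proc) set \<Rightarrow> bool" where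
  "rel_over_reach A \<tau> B \<longleftrightarrow> B \<subseteq> reach A \<tau> \<times> reach A \<tau> \<and> sym B"

definition forward_bisim :: "'a set \<Rightarrow> 'a \<Rightarrow> ('a proc \<times> 'a proc) set \<Rightarrow> bool" where
  "forward_bisim A \<tau> B \<longleftrightarrow> rel_over_reach A \<tau> B \<and>
    (\<forall>P1 P2. (P1, P2) \<in> B \<longrightarrow>
      (\<forall>\<theta>1 P1'. transition P1 \<theta>1 P1' \<longrightarrow>
        (\<exists>\<theta>2 P2'. transition P2 \<theta>2 P2' \<and> act \<theta>1 = act \<theta>2 \<and> (P1', P2') \<in> B)))"

text \<open>
  The incoming transitions considered are those of the state space \<open>reach A \<tau>\<close> over which \<open>B\<close>
  ranges. The restriction \<open>P1' \<in> reach A \<tau>\<close> matters, because a reachable process may have an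
  unreachable well-formed predecessor. Writing \<open>a!\<close> for an executed \<open>a\<close>, the process
  \<open>(a!.0 \<parallel>\<^bsub>{}\<^esub> c!.a!.0) \<parallel>\<^bsub>{a,c}\<^esub> a!.c!.a!.0\<close> is reachable, and it is the target of a transition
  from \<open>(a.0 \<parallel>\<^bsub>{}\<^esub> c!.a!.0) \<parallel>\<^bsub>{a,c}\<^esub> a!.c!.a.0\<close>, which is not. Without the restriction such a
  process would not be related to itself by any reverse bisimulation, although each of its two
  parallel components is.
\<close>

definition reverse_bisim :: "'a set \<Rightarrow> 'a \<Rightarrow> ('a proc \<times> 'a proc) set \<Rightarrow> bool" where
  "reverse_bisim A \<tau> B \<longleftrightarrow> rel_over_reach A \<tau> B \<and>
    (\<forall>P1 P2. (P1, P2) \<in> B \<longrightarrow>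
      (\<forall>\<theta>1. \<forall>P1' \<in> reach A \<tau>. transition P1' \<theta>1 P1 \<longrightarrow>
        (\<exists>\<theta>2 P2'. transition P2' \<theta>2 P2 \<and> act \<theta>1 = act \<theta>2 \<and> (P1', P2') \<in> B)))"

definition forward_reverse_bisim :: "'a set \<Rightarrow> 'a \<Rightarrow> ('a proc \<times> 'a proc) set \<Rightarrow> bool" where
  "forward_reverse_bisim A \<tau> B \<longleftrightarrow> forward_bisim A \<tau> B \<and> reverse_bisim A \<tau> B"

definition past_sensitive_forward_bisim :: "'a set \<Rightarrow> 'a \<Rightarrow> ('a proc \<times> 'a proc) set \<Rightarrow> bool" where
  "past_sensitive_forward_bisim A \<tau> B \<longleftrightarrow> forward_bisim A \<tau> B \<and>
    (\<forall>P1 P2. (P1, P2) \<in> B \<longrightarrow> (initial P1 \<longleftrightarrow> initial P2))"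

definition sim_FB :: "'a set \<Rightarrow> 'a \<Rightarrow> ('a proc \<times> 'a proc) set" where
  "sim_FB A \<tau> = \<Union> {B. forward_bisim A \<tau> B}"

definition sim_RB :: "'a set \<Rightarrow> 'a \<Rightarrow> ('a proc \<times> 'a proc) set" where
  "sim_RB A \<tau> = \<Union> {B. reverse_bisim A \<tau> B}"

definition sim_FRB :: "'a set \<Rightarrow> 'a \<Rightarrow> ('a proc \<times> 'a proc) set" where
  "sim_FRB A \<tau> = \<Union> {B. forward_reverse_bisim A \<tau> B}"

definition sim_FBps :: "'a set \<Rightarrow> 'a \<Rightarrow> ('a proc \<times> 'a proc) set" where
  "sim_FBps A \<tau> = \<Union> {B. past_sensitive_forward_bisim A \<tau> B}"

end

theory Submission
  imports Defs
begin

text \<open>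
  Given bisimulations \<open>B\<close> and \<open>C\<close> of the same kind, the pairs of reachable parallel compositions
  whose left components are related by \<open>B\<close> and right components by \<open>C\<close> form again a bisimulation of
  that kind; the theorem is the case in which one of the two is the identity. The delicate point is
  the reverse case, where the matching predecessor must be shown to be reachable. A computation
  leading from an initial process to \<open>P1 \<parallel>\<^bsub>L\<^esub> Q1\<close> can be replayed backwards, component by component,
  from \<open>P2 \<parallel>\<^bsub>L\<^esub> Q2\<close>. It ends in an initial process, because a reachable process is initial
  precisely if it has no reachable predecessor, a property that reverse bisimulations preserve.
\<close>

\<comment> \<open>Initial, well-formed and reachable processes\<close>
inductive_simps initial_Done_iff: "initial (Done a P)"
inductive_simps initial_Choice_iff: "initial (Choice P Q)"
inductive_simps initial_Par_iff: "initial (Par P L Q)"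
inductive_cases terms_PrefixE: "Prefix a P \<in> terms A \<tau>"
inductive_cases terms_DoneE: "Done a P \<in> terms A \<tau>"
inductive_cases terms_ChoiceE: "Choice P Q \<in> terms A \<tau>"
inductive_cases terms_ParE: "Par P L Q \<in> terms A \<tau>"

lemma initial_imp_well_formed: "initial P \<Longrightarrow> well_formed P"
  by (induction rule: initial.induct) (auto intro: well_formed.intros)

lemma transition_target_well_formed: "transition P \<theta> P' \<Longrightarrow> well_formed P'"
  by (induction rule: transition.induct)
    (auto intro: well_formed.intros initial_imp_well_formed)

text \<open>A step leaves a \<open>Done\<close> prefix in its target, and an initial process
  contains none.\<close>

lemma transition_target_not_initial: "transition P \<theta> P' \<Longrightarrow> \<not> initial P'"
  by (induction rule: transition.induct)
    (auto simp: initial_Done_iff initial_Choice_iff initial_Par_iff)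

lemma transition_terms: "transition P \<theta> P' \<Longrightarrow> P \<in> terms A \<tau> \<Longrightarrow> P' \<in> terms A \<tau>"
  by (induction rule: transition.induct)
    (auto intro: terms.intros elim!: terms_PrefixE terms_DoneE terms_ChoiceE terms_ParE)

lemma reach_terms: "P \<in> reach A \<tau> \<Longrightarrow> P \<in> terms A \<tau>"
  by (induction rule: reach.induct) (auto intro: transition_terms)

lemma reach_well_formed: "P \<in> reach A \<tau> \<Longrightarrow> well_formed P"
  by (induction rule: reach.induct)
    (auto intro: initial_imp_well_formed transition_target_well_formed)

text \<open>A computation of the composition projects to one of each component. The converse can
  fail: for \<open>a \<in> L\<close>, the process \<open>Par (Done a Stop) L Stop\<close> has
  reachable components, but the executed \<open>a\<close> lacks a synchronization partner.\<close>

lemma reach_Par_components: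
  assumes "Par P L Q \<in> reach A \<tau>"
  shows "P \<in> reach A \<tau> \<and> Q \<in> reach A \<tau>"
  using assms
proof (induction "Par P L Q" arbitrary: P Q rule: reach.induct)
  case reach_initial
  then show ?case
    by (auto intro: reach.reach_initial elim: terms_ParE simp: initial_Par_iff)
next
  case (reach_step R \<theta>)
  from reach_step.hyps(3) show ?case
    by cases (auto dest: reach_step.hyps(2) intro: reach.reach_step)
qed

section \<open>Matching steps of related processes\<close>

lemma forward_bisim_step:
  assumes "forward_bisim A \<tau> B" "(P1, P2) \<in> B" "transition P1 \<theta>1 P1'"
  obtains \<theta>2 P2' where "transition P2 \<theta>2 P2'" "act \<theta>2 = act \<theta>1" "(P1', P2') \<in> B"
proof -
  have "\<exists>\<theta>2 P2'. transition P2 \<theta>2 P2' \<and> act \<theta>1 = act \<theta>2 \<and> (P1', P2') \<in> B"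
    using assms unfolding forward_bisim_def by blast
  then show ?thesis using that by fastforce
qed

lemma reverse_bisim_step:
  assumes "reverse_bisim A \<tau> B" "(P1, P2) \<in> B" "transition P1' \<theta>1 P1" "P1' \<in> reach A \<tau>"
  obtains \<theta>2 P2' where "transition P2' \<theta>2 P2" "act \<theta>2 = act \<theta>1" "(P1', P2') \<in> B"
proof -
  have "\<exists>\<theta>2 P2'. transition P2' \<theta>2 P2 \<and> act \<theta>1 = act \<theta>2 \<and> (P1', P2') \<in> B"
    using assms unfolding reverse_bisim_def by blast
  then show ?thesis using that by fastforce
qed

lemma rel_over_reachD:
  assumes "rel_over_reach A \<tau> B" "(P, Q) \<in> B"
  shows "P \<in> reach A \<tau>" "Q \<in> reach A \<tau>" "(Q, P) \<in> B"
  using assms unfolding rel_over_reach_def by (auto dest: symD)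

lemma rel_over_reach_well_formed:
  assumes "rel_over_reach A \<tau> B" "(P, Q) \<in> B"
  shows "well_formed P" "well_formed Q"
  using rel_over_reachD[OF assms] by (auto intro: reach_well_formed)

lemma forward_bisim_over_reach: "forward_bisim A \<tau> B \<Longrightarrow> rel_over_reach A \<tau> B"
  by (simp add: forward_bisim_def)

lemma reverse_bisim_over_reach: "reverse_bisim A \<tau> B \<Longrightarrow> rel_over_reach A \<tau> B"
  by (simp add: reverse_bisim_def)

text \<open>If \<open>P2\<close> were reached by a last step, symmetry of \<open>B\<close> would let
  \<open>P1\<close> match that step backwards, so \<open>P1\<close> would be the target of a
  transition. The other way of being reachable is to be initial, and \<open>qed\<close> closes that
  case.\<close>

lemma reverse_bisim_initial:
  assumes "reverse_bisim A \<tau> B" "(P1, P2) \<in> B" "initial P1"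
  shows "initial P2"
proof -
  note P2 = rel_over_reachD(2,3)[OF reverse_bisim_over_reach[OF assms(1)] assms(2)]
  from P2(1) show ?thesis
  proof cases
    case (reach_step P2' \<theta>)
    then obtain \<theta>1 P1' where "transition P1' \<theta>1 P1"
      using reverse_bisim_step[OF assms(1) P2(2)] by blast
    then show ?thesis using transition_target_not_initial assms(3) by blast
  qed
qed

section \<open>Componentwise related parallel compositions\<close>

text \<open>No reachability of the compositions is demanded here, so that a computation can be
  replayed backwards before its replayed states are known to be reachable.\<close>

inductive_set par_rel ::
    "('a proc \<times> 'a proc) set \<Rightarrow> 'a set \<Rightarrow> ('a proc \<times> 'a proc) set \<Rightarrow> ('a proc \<times> 'a proc) set"
  for B :: "('a proc \<times> 'a proc) set" and L :: "'a set" and C :: "('a proc \<times> 'a proc) set" where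
  par_relI: "(P1, P2) \<in> B \<Longrightarrow> (Q1, Q2) \<in> C \<Longrightarrow> (Par P1 L Q1, Par P2 L Q2) \<in> par_rel B L C"

text \<open>The rules for \<open>Par\<close> see the proof terms of the components only through
  \<open>act\<close>, so matching component steps may be combined by the same rule. The idle
  component is well-formed because related processes are reachable.\<close>

lemma par_rel_forward_step:
  assumes B: "forward_bisim A \<tau> B" and C: "forward_bisim A \<tau> C"
    and "(R1, R2) \<in> par_rel B L C" and "transition R1 \<theta>1 R1'"
  shows "\<exists>\<theta>2 R2'. transition R2 \<theta>2 R2' \<and> act \<theta>1 = act \<theta>2 \<and> (R1', R2') \<in> par_rel B L C"
  using assms(3)
proof cases
  case (par_relI P1 P2 Q1 Q2)
  note wf = rel_over_reach_well_formed[OF forward_bisim_over_reach[OF B] par_relI(3)]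
    rel_over_reach_well_formed[OF forward_bisim_over_reach[OF C] par_relI(4)]
  from assms(4) have "transition (Par P1 L Q1) \<theta>1 R1'" using par_relI by simp
  then show ?thesis
  proof cases
    case (transition_ParL \<theta> P1' a)
    obtain \<theta>2 P2' where "transition P2 \<theta>2 P2'" "act \<theta>2 = act \<theta>" "(P1', P2') \<in> B"
      using forward_bisim_step[OF B par_relI(3)] transition_ParL by metis
    with transition_ParL par_relI wf show ?thesis
      by (intro exI[of _ "ParL \<theta>2"] exI[of _ "Par P2' L Q2"])
        (auto intro: transition.transition_ParL par_rel.intros)
  next
    case (transition_ParR \<theta> Q1' a)
    obtain \<theta>2 Q2' where "transition Q2 \<theta>2 Q2'" "act \<theta>2 = act \<theta>" "(Q1', Q2') \<in> C"
      using forward_bisim_step[OF C par_relI(4)] transition_ParR by metis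
    with transition_ParR par_relI wf show ?thesis
      by (intro exI[of _ "ParR \<theta>2"] exI[of _ "Par P2 L Q2'"])
        (auto intro: transition.transition_ParR par_rel.intros)
  next
    case (transition_Sync \<theta> P1' \<eta> Q1' a)
    obtain \<theta>2 P2' where "transition P2 \<theta>2 P2'" "act \<theta>2 = act \<theta>" "(P1', P2') \<in> B"
      using forward_bisim_step[OF B par_relI(3)] transition_Sync by metis
    moreover obtain \<eta>2 Q2' where "transition Q2 \<eta>2 Q2'" "act \<eta>2 = act \<eta>" "(Q1', Q2') \<in> C"
      using forward_bisim_step[OF C par_relI(4)] transition_Sync by metis
    ultimately show ?thesis using transition_Sync par_relI
      by (intro exI[of _ "Sync \<theta>2 \<eta>2"] exI[of _ "Par P2' L Q2'"])
        (auto intro: transition.transition_Sync par_rel.intros)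
  qed
qed

text \<open>Reachability is assumed of \<open>R1'\<close> only and neither assumed of
  \<open>R2\<close> nor claimed of \<open>R2'\<close>, which allows the step to be iterated along a
  backward replay.\<close>

lemma par_rel_reverse_step:
  assumes B: "reverse_bisim A \<tau> B" and C: "reverse_bisim A \<tau> C"
    and "(R1, R2) \<in> par_rel B L C" and "transition R1' \<theta>1 R1" and reach: "R1' \<in> reach A \<tau>"
  shows "\<exists>\<theta>2 R2'. transition R2' \<theta>2 R2 \<and> act \<theta>1 = act \<theta>2 \<and> (R1', R2') \<in> par_rel B L C"
  using assms(3)
proof cases
  case (par_relI P1 P2 Q1 Q2)
  note wf = rel_over_reach_well_formed[OF reverse_bisim_over_reach[OF B] par_relI(3)]
    rel_over_reach_well_formed[OF reverse_bisim_over_reach[OF C] par_relI(4)]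
  from assms(4) have "transition R1' \<theta>1 (Par P1 L Q1)" using par_relI by simp
  then show ?thesis
  proof cases
    case (transition_ParL P1' \<theta> a)
    \<comment> \<open>The reverse clause of \<open>B\<close> speaks about reachable predecessors
      only, so reachability of \<open>R1'\<close> is projected to the component that moved.\<close>
    then have "P1' \<in> reach A \<tau>" using reach by (auto dest: reach_Par_components)
    then obtain \<theta>2 P2' where "transition P2' \<theta>2 P2" "act \<theta>2 = act \<theta>" "(P1', P2') \<in> B"
      using reverse_bisim_step[OF B par_relI(3)] transition_ParL by metis
    with transition_ParL par_relI wf show ?thesis
      by (intro exI[of _ "ParL \<theta>2"] exI[of _ "Par P2' L Q2"])
        (auto intro: transition.transition_ParL par_rel.intros)
  next
    case (transition_ParR Q1' \<theta> a)
    then have "Q1' \<in> reach A \<tau>" using reach by (auto dest: reach_Par_components)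
    then obtain \<theta>2 Q2' where "transition Q2' \<theta>2 Q2" "act \<theta>2 = act \<theta>" "(Q1', Q2') \<in> C"
      using reverse_bisim_step[OF C par_relI(4)] transition_ParR by metis
    with transition_ParR par_relI wf show ?thesis
      by (intro exI[of _ "ParR \<theta>2"] exI[of _ "Par P2 L Q2'"])
        (auto intro: transition.transition_ParR par_rel.intros)
  next
    case (transition_Sync P1' \<theta> Q1' \<eta> a)
    have "P1' \<in> reach A \<tau>" "Q1' \<in> reach A \<tau>" using transition_Sync reach by (auto dest: reach_Par_components)
    obtain \<theta>2 P2' where "transition P2' \<theta>2 P2" "act \<theta>2 = act \<theta>" "(P1', P2') \<in> B"
      using reverse_bisim_step[OF B par_relI(3) _ \<open>P1' \<in> reach A \<tau>\<close>] transition_Sync by metis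
    moreover obtain \<eta>2 Q2' where "transition Q2' \<eta>2 Q2" "act \<eta>2 = act \<eta>" "(Q1', Q2') \<in> C"
      using reverse_bisim_step[OF C par_relI(4) _ \<open>Q1' \<in> reach A \<tau>\<close>] transition_Sync by metis
    ultimately show ?thesis using transition_Sync par_relI
      by (intro exI[of _ "Sync \<theta>2 \<eta>2"] exI[of _ "Par P2' L Q2'"])
        (auto intro: transition.transition_Sync par_rel.intros)
  qed
qed

text \<open>Induction along the computation that reaches \<open>R1\<close>; its steps are matched
  from the last one back to the first.\<close>

lemma par_rel_reverse_reach:
  assumes B: "reverse_bisim A \<tau> B" and C: "reverse_bisim A \<tau> C"
    and "R1 \<in> reach A \<tau>" and "(R1, R2) \<in> par_rel B L C"
  shows "R2 \<in> reach A \<tau>"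
  using assms(3,4)
proof (induction R1 arbitrary: R2 rule: reach.induct)
  case (reach_initial R1)
  from reach_initial.prems show ?case
  proof cases
    case (par_relI P1 P2 Q1 Q2)
    have "initial P2" "initial Q2"
      using reverse_bisim_initial[OF B par_relI(3)] reverse_bisim_initial[OF C par_relI(4)]
        reach_initial.hyps par_relI(1) by (auto simp: initial_Par_iff)
    moreover have "P2 \<in> terms A \<tau>" "Q2 \<in> terms A \<tau>"
      using rel_over_reachD(2)[OF reverse_bisim_over_reach[OF B] par_relI(3)]
        rel_over_reachD(2)[OF reverse_bisim_over_reach[OF C] par_relI(4)]
      by (auto intro: reach_terms)
    \<comment> \<open>\<open>L\<close> is arbitrary in this lemma; that it is a legal
      synchronization set is read off from \<open>R1\<close> being a term.\<close>
    moreover have "L \<subseteq> A - {\<tau>}"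
      using reach_initial.hyps(1) par_relI(1) by (auto elim: terms_ParE)
    ultimately show ?thesis
      using par_relI(2) by (auto intro: reach.reach_initial initial_Par terms_Par)
  qed
next
  \<comment> \<open>The last step into \<open>R1\<close> is matched by a step into \<open>R2\<close>
    from some \<open>R2'\<close> related to \<open>R1'\<close>. By induction \<open>R2'\<close> is
    reachable, hence so is \<open>R2\<close>.\<close>
  case (reach_step R1' \<theta> R1)
  then show ?case
    using par_rel_reverse_step[OF B C] by (meson reach.reach_step)
qed

section \<open>Bisimulations between reachable parallel compositions\<close>

text \<open>Bisimulations range over reachable processes, whereas \<open>par_rel\<close> may relate
  unreachable compositions of reachable components.\<close>

definition par_rel_reach where
  "par_rel_reach A \<tau> B L C = par_rel B L C \<inter> (reach A \<tau> \<times> reach A \<tau>)"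

lemma rel_over_reach_par:
  assumes "rel_over_reach A \<tau> B" and "rel_over_reach A \<tau> C"
  shows "rel_over_reach A \<tau> (par_rel_reach A \<tau> B L C)"
  using assms unfolding rel_over_reach_def par_rel_reach_def
  by (auto simp: sym_def elim!: par_rel.cases intro: par_relI)

lemma forward_bisim_par:
  assumes "forward_bisim A \<tau> B" and "forward_bisim A \<tau> C"
  shows "forward_bisim A \<tau> (par_rel_reach A \<tau> B L C)"
  unfolding forward_bisim_def
proof (intro conjI allI impI)
  show "rel_over_reach A \<tau> (par_rel_reach A \<tau> B L C)"
    using assms by (intro rel_over_reach_par forward_bisim_over_reach)
next
  fix R1 R2 \<theta>1 R1'
  assume R: "(R1, R2) \<in> par_rel_reach A \<tau> B L C" and step: "transition R1 \<theta>1 R1'"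
  obtain \<theta>2 R2' where "transition R2 \<theta>2 R2'" "act \<theta>1 = act \<theta>2" "(R1', R2') \<in> par_rel B L C"
    using par_rel_forward_step[OF assms _ step, of R2 L] R by (auto simp: par_rel_reach_def)
  \<comment> \<open>Both targets are reachable because \<open>reach\<close> is closed under forward
    steps.\<close>
  with R step show "\<exists>\<theta>2 R2'. transition R2 \<theta>2 R2' \<and> act \<theta>1 = act \<theta>2 \<and>
      (R1', R2') \<in> par_rel_reach A \<tau> B L C"
    by (auto simp: par_rel_reach_def intro: reach_step)
qed

text \<open>Backward steps need not preserve reachability. The matching predecessor is reachable by
  \<open>par_rel_reverse_reach\<close>, applied to the pair of predecessors.\<close>

lemma reverse_bisim_par:
  assumes "reverse_bisim A \<tau> B" and "reverse_bisim A \<tau> C"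
  shows "reverse_bisim A \<tau> (par_rel_reach A \<tau> B L C)"
  unfolding reverse_bisim_def
proof (intro conjI allI impI ballI)
  show "rel_over_reach A \<tau> (par_rel_reach A \<tau> B L C)"
    using assms by (intro rel_over_reach_par reverse_bisim_over_reach)
next
  fix R1 R2 \<theta>1 R1'
  assume "(R1, R2) \<in> par_rel_reach A \<tau> B L C" and "transition R1' \<theta>1 R1" and "R1' \<in> reach A \<tau>"
  then show "\<exists>\<theta>2 R2'. transition R2' \<theta>2 R2 \<and> act \<theta>1 = act \<theta>2 \<and>
      (R1', R2') \<in> par_rel_reach A \<tau> B L C"
    using par_rel_reverse_step[OF assms] par_rel_reverse_reach[OF assms]
    unfolding par_rel_reach_def by (meson IntD1 IntI SigmaI)
qed

lemma forward_reverse_bisim_par: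
  assumes "forward_reverse_bisim A \<tau> B" and "forward_reverse_bisim A \<tau> C"
  shows "forward_reverse_bisim A \<tau> (par_rel_reach A \<tau> B L C)"
  using assms unfolding forward_reverse_bisim_def
  by (auto intro: forward_bisim_par reverse_bisim_par)

text \<open>Initiality of a composition is the conjunction over its components, so agreement on it
  carries over.\<close>

lemma past_sensitive_forward_bisim_par:
  assumes "past_sensitive_forward_bisim A \<tau> B" and "past_sensitive_forward_bisim A \<tau> C"
  shows "past_sensitive_forward_bisim A \<tau> (par_rel_reach A \<tau> B L C)"
  using assms unfolding past_sensitive_forward_bisim_def
  by (auto intro!: forward_bisim_par)
    (auto simp: par_rel_reach_def initial_Par_iff elim!: par_rel.cases)

section \<open>The identity as a bisimulation of each kind\<close>

lemma forward_bisim_Id: "forward_bisim A \<tau> (Id_on (reach A \<tau>))"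
  unfolding forward_bisim_def rel_over_reach_def
  by (auto simp: sym_def Id_on_iff intro: reach_step)

lemma reverse_bisim_Id: "reverse_bisim A \<tau> (Id_on (reach A \<tau>))"
  unfolding reverse_bisim_def rel_over_reach_def by (auto simp: sym_def Id_on_iff)

lemma forward_reverse_bisim_Id: "forward_reverse_bisim A \<tau> (Id_on (reach A \<tau>))"
  by (simp add: forward_reverse_bisim_def forward_bisim_Id reverse_bisim_Id)

lemma past_sensitive_forward_bisim_Id:
  "past_sensitive_forward_bisim A \<tau> (Id_on (reach A \<tau>))"
  by (auto simp: past_sensitive_forward_bisim_def forward_bisim_Id)

section \<open>Congruence for parallel composition\<close>

text \<open>The argument shared by the four equivalences, with the kind of bisimulation abstracted
  to a predicate \<open>bisim\<close>.\<close>

lemma union_of_bisims_par_congruence: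
  assumes par: "\<And>B C. bisim B \<Longrightarrow> bisim C \<Longrightarrow> bisim (par_rel_reach A \<tau> B L C)"
    and Id: "bisim (Id_on (reach A \<tau>))"
    and "(P1, P2) \<in> \<Union> {B. bisim B}" and P: "P \<in> reach A \<tau>"
    and reach: "Par P1 L P \<in> reach A \<tau>" "Par P2 L P \<in> reach A \<tau>"
      "Par P L P1 \<in> reach A \<tau>" "Par P L P2 \<in> reach A \<tau>"
  shows "(Par P1 L P, Par P2 L P) \<in> \<Union> {B. bisim B} \<and>
    (Par P L P1, Par P L P2) \<in> \<Union> {B. bisim B}"
proof -
  obtain B where B: "bisim B" "(P1, P2) \<in> B" using assms(3) by blast
  \<comment> \<open>The fixed context \<open>P\<close> is related to itself by the identity, placed
    on the right or on the left of \<open>B\<close>.\<close>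
  have "(Par P1 L P, Par P2 L P) \<in> par_rel_reach A \<tau> B L (Id_on (reach A \<tau>))"
    "(Par P L P1, Par P L P2) \<in> par_rel_reach A \<tau> (Id_on (reach A \<tau>)) L B"
    using B(2) P reach by (auto simp: par_rel_reach_def intro: par_relI)
  then show ?thesis using par[OF B(1) Id] par[OF Id B(1)] by blast
qed

theorem theorem1:
  fixes A :: "'a set" and \<tau> :: 'a
    and R :: "('a proc \<times> 'a proc) set"
    and P1 P2 :: "'a proc"
  assumes "countable A" and "\<tau> \<in> A"
    and "R \<in> {sim_FB A \<tau>, sim_FBps A \<tau>, sim_RB A \<tau>, sim_FRB A \<tau>}"
    and "P1 \<in> reach A \<tau>" and "P2 \<in> reach A \<tau>"
    and "(P1, P2) \<in> R"
  shows "\<forall>P \<in> reach A \<tau>. \<forall>L. L \<subseteq> A - {\<tau>} \<longrightarrow>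
    Par P1 L P \<in> reach A \<tau> \<longrightarrow> Par P2 L P \<in> reach A \<tau> \<longrightarrow>
    Par P L P1 \<in> reach A \<tau> \<longrightarrow> Par P L P2 \<in> reach A \<tau> \<longrightarrow>
    (Par P1 L P, Par P2 L P) \<in> R \<and> (Par P L P1, Par P L P2) \<in> R"
proof (intro ballI allI impI)
  fix P L
  assume reach: "P \<in> reach A \<tau>" "Par P1 L P \<in> reach A \<tau>" "Par P2 L P \<in> reach A \<tau>"
    "Par P L P1 \<in> reach A \<tau>" "Par P L P2 \<in> reach A \<tau>"
  \<comment> \<open>Each of the four choices of \<open>R\<close> is the union of all bisimulations
    of one kind; \<open>bisim\<close> is instantiated to that kind.\<close>
  obtain bisim where R: "R = \<Union> {B. bisim B}"
    and par: "\<And>B C. bisim B \<Longrightarrow> bisim C \<Longrightarrow> bisim (par_rel_reach A \<tau> B L C)"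
    and Id: "bisim (Id_on (reach A \<tau>))"
  proof -
    consider "R = sim_FB A \<tau>" | "R = sim_FBps A \<tau>" | "R = sim_RB A \<tau>" | "R = sim_FRB A \<tau>"
      using assms(3) by blast
    then show thesis
    proof cases
      case 1
      then show thesis
        using that[OF _ forward_bisim_par forward_bisim_Id] by (simp add: sim_FB_def)
    next
      case 2
      then show thesis
        using that[OF _ past_sensitive_forward_bisim_par past_sensitive_forward_bisim_Id]
        by (simp add: sim_FBps_def)
    next
      case 3
      then show thesis
        using that[OF _ reverse_bisim_par reverse_bisim_Id] by (simp add: sim_RB_def)
    next
      case 4
      then show thesis
        using that[OF _ forward_reverse_bisim_par forward_reverse_bisim_Id]
        by (simp add: sim_FRB_def)
    qed
  qed
  show "(Par P1 L P, Par P2 L P) \<in> R \<and> (Par P L P1, Par P L P2) \<in> R"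
    using union_of_bisims_par_congruence[of bisim, OF par Id assms(6)[unfolded R]] reach
    by (simp add: R)
qed

end
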